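(* Let $e_i(a)$, $a\ge0$, be a Chevalley generator. If $X\in RW$, then $e_i(a)X\in RW$. If $X\in RC$, then $e_i(a)X\in RC$.
   Context: Fix $n\ge1$. All matrices are doubly infinite real matrices $X=(x_{i,j})_{i,j\in\mathbb{Z}}$ with $x_{i+n,j+n}=x_{i,j}$, upper triangular with $1$'s on the diagonal. The Chevalley generator $e_k(a)$ has $1$'s on the diagonal, $(i,i+1)$ entry $a$ if $i\equiv k\pmod n$, and all other entries $0$ (when $n=1$ there are no Chevalley generators). The whirl $M(a_1,\dots,a_n)$ has $m_{i,i}=1$, $m_{i,i+1}=a_i$ (index modulo $n$), other entries $0$. The curl $N(a_1,\dots,a_n)$ has $1$'s on the diagonal, $(i,j)$ entry $a_ia_{i+1}\cdots a_{j-1}$ for $i<j$ (indices modulo $n$), and $0$ below the diagonal. Limits of matrices are entrywise, and $\prod_{i=1}^\infty X^{(i)}=\lim_{k\to\infty}X^{(1)}\cdots X^{(k)}$. $RC$ (resp. $RW$) is the set of all matrices $\prod_{i=1}^\infty N(a^{(i)}_1,\dots,a^{(i)}_n)$ (resp. $\prod_{i=1}^\infty M(a^{(i)}_1,\dots,a^{(i)}_n)$) with all $a^{(i)}_j>0$ and $\sum_{i,j}a^{(i)}_j<\infty$. *)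

theory Defs
  imports "HOL-Analysis.Analysis" "HOL-Number_Theory.Cong"
begin

text \<open>A doubly infinite matrix is a function of its row and column index.\<close>
type_synonym imat = "int \<Rightarrow> int \<Rightarrow> real"

text \<open>The standing assumption on matrices. It is not imposed separately below, since all
  matrices involved satisfy it: see \<open>is_chevalley_in_U\<close>, \<open>RW_subset_U\<close> and \<open>RC_subset_U\<close>.\<close>
definition U :: "nat \<Rightarrow> imat set" where
  "U n = {X. (\<forall>i j. X (i + int n) (j + int n) = X i j) \<and>
             (\<forall>i. X i i = 1) \<and> (\<forall>i j. j < i \<longrightarrow> X i j = 0)}"

definition one_mat :: imat where
  "one_mat i j = (if i = j then 1 else 0)"

text \<open>For upper triangular matrices the terms of the full sum over all \<open>k\<close> vanish outside
  \<open>i \<le> k \<le> j\<close>.\<close>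
definition mat_mul :: "imat \<Rightarrow> imat \<Rightarrow> imat" (infixl "\<odot>" 70) where
  "(X \<odot> Y) i j = (\<Sum>k=i..j. X i k * Y k j)"

primrec partial_prod :: "(nat \<Rightarrow> imat) \<Rightarrow> nat \<Rightarrow> imat" where
  "partial_prod X 0 = one_mat"
| "partial_prod X (Suc k) = partial_prod X k \<odot> X k"

text \<open>The factors are numbered from 0 instead of 1.\<close>
definition is_infinite_prod :: "(nat \<Rightarrow> imat) \<Rightarrow> imat \<Rightarrow> bool" where
  "is_infinite_prod X P \<longleftrightarrow> (\<forall>i j. (\<lambda>k. partial_prod X k i j) \<longlonglongrightarrow> P i j)"

text \<open>There are no Chevalley generators when \<open>n = 1\<close>.\<close>
definition is_chevalley :: "nat \<Rightarrow> int \<Rightarrow> real \<Rightarrow> imat \<Rightarrow> bool" where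
  "is_chevalley n k a E \<longleftrightarrow> n \<ge> 2 \<and>
     (\<forall>i j. E i j = (if j = i then 1
                     else if j = i + 1 \<and> [i = k] (mod int n) then a
                     else 0))"

text \<open>The representative in \<open>{1..n}\<close> of an index modulo \<open>n\<close>; thus \<open>whirl n a\<close> and
  \<open>curl n a\<close> depend only on \<open>a 1, \<dots>, a n\<close>.\<close>
definition idx :: "nat \<Rightarrow> int \<Rightarrow> nat" where
  "idx n i = nat ((i - 1) mod int n) + 1"

definition whirl :: "nat \<Rightarrow> (nat \<Rightarrow> real) \<Rightarrow> imat" where
  "whirl n a i j = (if j = i then 1 else if j = i + 1 then a (idx n i) else 0)"

definition curl :: "nat \<Rightarrow> (nat \<Rightarrow> real) \<Rightarrow> imat" where
  "curl n a i j = (if j = i then 1 else if i < j then (\<Prod>k=i..<j. a (idx n k)) else 0)"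

definition admissible :: "nat \<Rightarrow> (nat \<Rightarrow> nat \<Rightarrow> real) \<Rightarrow> bool" where
  "admissible n a \<longleftrightarrow> (\<forall>i. \<forall>j\<in>{1..n}. a i j > 0) \<and>
     (\<lambda>(i, j). a i j) summable_on (UNIV \<times> {1..n})"

definition RW :: "nat \<Rightarrow> imat set" where
  "RW n = {X. \<exists>a. admissible n a \<and> is_infinite_prod (\<lambda>i. whirl n (a i)) X}"

definition RC :: "nat \<Rightarrow> imat set" where
  "RC n = {X. \<exists>a. admissible n a \<and> is_infinite_prod (\<lambda>i. curl n (a i)) X}"

lemma idx_in_range:
  assumes "n \<ge> 1"
  shows "idx n i \<in> {1..n}"
proof -
  have "(i - 1) mod int n < int n" "(i - 1) mod int n \<ge> 0"
    using assms by simp_all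
  then show ?thesis
    unfolding idx_def atLeastAtMost_iff by linarith
qed

lemma idx_add_period: "idx n (i + int n) = idx n i"
proof -
  have "(i + int n - 1) mod int n = (i - 1 + int n) mod int n"
    by (simp add: algebra_simps)
  then show ?thesis
    by (simp add: idx_def)
qed

lemma is_chevalley_in_U: "is_chevalley n k a E \<Longrightarrow> E \<in> U n"
  by (auto simp: is_chevalley_def U_def cong_def)

lemma whirl_in_U: "whirl n a \<in> U n"
  by (auto simp: whirl_def U_def idx_add_period)

lemma curl_in_U: "curl n a \<in> U n"
proof -
  have "(\<Prod>k=i + int n..<j + int n. a (idx n k)) = (\<Prod>k=i..<j. a (idx n k))" for i j
    by (rule prod.reindex_bij_witness[of _ "\<lambda>k. k + int n" "\<lambda>k. k - int n"])
       (auto simp: idx_add_period[of n "_ - int n", symmetric])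
  then show ?thesis
    by (auto simp: curl_def U_def)
qed

lemma mat_mul_in_U:
  assumes "X \<in> U n" "Y \<in> U n"
  shows "X \<odot> Y \<in> U n"
proof -
  have "(X \<odot> Y) (i + int n) (j + int n) = (X \<odot> Y) i j" for i j
    unfolding mat_mul_def
  proof (rule sum.reindex_bij_witness[of _ "\<lambda>k. k + int n" "\<lambda>k. k - int n"])
    fix k
    have "X (i + int n) (k - int n + int n) = X i (k - int n)"
         "Y (k - int n + int n) (j + int n) = Y (k - int n) j"
      using assms unfolding U_def by blast+
    then show "X i (k - int n) * Y (k - int n) j = X (i + int n) k * Y k (j + int n)"
      by simp
  qed auto
  then show ?thesis
    using assms by (auto simp: U_def mat_mul_def)
qed

lemma infinite_prod_in_U:
  assumes "\<And>k. X k \<in> U n" "is_infinite_prod X P"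
  shows "P \<in> U n"
proof -
  have partial: "partial_prod X k \<in> U n" for k
  proof (induction k)
    case 0
    show ?case by (auto simp: U_def one_mat_def)
  qed (simp add: mat_mul_in_U assms(1))
  have lim: "(\<lambda>k. partial_prod X k i j) \<longlonglongrightarrow> P i j" for i j
    using assms(2) by (simp add: is_infinite_prod_def)
  have "P (i + int n) (j + int n) = P i j" for i j
    using LIMSEQ_unique[OF lim[of "i + int n" "j + int n"], of "P i j"] lim[of i j] partial
    by (simp add: U_def)
  moreover have "P i i = 1" for i
    using LIMSEQ_unique[OF lim[of i i], of 1] partial by (simp add: U_def)
  moreover have "P i j = 0" if "j < i" for i j
    using LIMSEQ_unique[OF lim[of i j], of 0] partial that by (simp add: U_def)
  ultimately show ?thesis
    by (simp add: U_def)
qed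

lemma RW_subset_U: "RW n \<subseteq> U n"
  by (auto simp: RW_def intro: infinite_prod_in_U whirl_in_U)

lemma RC_subset_U: "RC n \<subseteq> U n"
  by (auto simp: RC_def intro: infinite_prod_in_U curl_in_U)

end

theory Submission imports Defs begin

text \<open>
  A Chevalley generator can be moved to the right through a whirl or a curl. Write \<open>e k a\<close> for the
  generator with parameter \<open>a\<close> in the residue class of \<open>k\<close>. For positive \<open>b\<close> and \<open>a \<ge> 0\<close> there is
  an exchange \<open>e k a \<odot> M(b) = M(b') \<odot> e (k + 1) a'\<close>, and likewise
  \<open>e k a \<odot> N(b) = N(b') \<odot> e (k - 1) a'\<close>. With \<open>l = k + 1\<close> for a whirl and \<open>l = k - 1\<close> for a curl,
  both are given by the same formulas
  \<open>a' = a b\<^sub>l / (a + b\<^sub>k)\<close>, \<open>b'\<^sub>k = b\<^sub>k + a\<close>, \<open>b'\<^sub>l = b\<^sub>l - a'\<close>, the other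
  parameters being unchanged (lemmas \<open>chev_whirl\<close> and \<open>chev_curl\<close>). Here \<open>0 \<le> a' < b\<^sub>l\<close>, so \<open>b'\<close> is
  again positive.

  Pushing the generator through the first \<open>r + 1\<close> factors of an infinite product turns
  \<open>E \<odot> X\<^sub>0 \<odot> \<dots> \<odot> X\<^sub>r\<close> into \<open>Y\<^sub>0 \<odot> \<dots> \<odot> Y\<^sub>r \<odot> E'\<close>, where the \<open>Y\<close> are
  whirls (curls) with new parameters and \<open>E'\<close> is a generator whose parameter is less than one of the
  parameters of \<open>X\<^sub>r\<close>. Since the parameters of all the \<open>X\<close> together are summable, so are those of the
  successive generators. They therefore tend to 0, so that \<open>E'\<close> disappears in the limit
  (\<open>infinite_prod_exchange\<close>), and they are the only increase in the parameters of
  the \<open>Y\<close>, which remain summable (\<open>chev_absorbed\<close>).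
\<close>

section \<open>Multiplication of upper triangular matrices\<close>

lemma mat_mul_assoc: "(X \<odot> Y) \<odot> Z = X \<odot> (Y \<odot> Z)"
proof (intro ext)
  fix i j
  have "((X \<odot> Y) \<odot> Z) i j = (\<Sum>k=i..j. \<Sum>l=i..k. X i l * Y l k * Z k j)"
    by (simp add: mat_mul_def sum_distrib_right)
  also have "\<dots> = (\<Sum>k=i..j. \<Sum>l\<in>{l\<in>{i..j}. l \<le> k}. X i l * Y l k * Z k j)"
    by (intro sum.cong) auto
  also have "\<dots> = (\<Sum>l=i..j. \<Sum>k\<in>{k\<in>{i..j}. l \<le> k}. X i l * Y l k * Z k j)"
    by (rule sum.swap_restrict) auto
  also have "\<dots> = (\<Sum>l=i..j. \<Sum>k=l..j. X i l * Y l k * Z k j)"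
    by (intro sum.cong) auto
  also have "\<dots> = (X \<odot> (Y \<odot> Z)) i j"
    by (simp add: mat_mul_def sum_distrib_left mult.assoc)
  finally show "((X \<odot> Y) \<odot> Z) i j = (X \<odot> (Y \<odot> Z)) i j" .
qed

definition upper_tri :: "imat \<Rightarrow> bool" where
  "upper_tri X \<longleftrightarrow> (\<forall>i j. j < i \<longrightarrow> X i j = 0)"

lemma upper_tri_zero: "upper_tri X \<Longrightarrow> j < i \<Longrightarrow> X i j = 0"
  by (simp add: upper_tri_def)

lemma upper_tri_one: "upper_tri one_mat"
  by (simp add: upper_tri_def one_mat_def)

lemma upper_tri_mat_mul: "upper_tri (X \<odot> Y)"
  by (simp add: upper_tri_def mat_mul_def)

lemma upper_tri_partial_prod: "upper_tri (partial_prod X r)"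
  by (cases r) (simp_all add: upper_tri_one upper_tri_mat_mul)

lemma one_mat_mul:
  assumes "upper_tri X"
  shows "one_mat \<odot> X = X"
proof (intro ext)
  fix i j
  show "(one_mat \<odot> X) i j = X i j"
    using assms by (cases "i \<le> j") (auto simp: mat_mul_def one_mat_def if_distrib
      if_distribR upper_tri_zero cong: if_cong)
qed

lemma mat_mul_one:
  assumes "upper_tri X"
  shows "X \<odot> one_mat = X"
proof (intro ext)
  fix i j
  show "(X \<odot> one_mat) i j = X i j"
    using assms by (cases "i \<le> j") (auto simp: mat_mul_def one_mat_def if_distrib
      upper_tri_zero cong: if_cong)
qed

definition nonneg_mat :: "imat \<Rightarrow> bool" where
  "nonneg_mat X \<longleftrightarrow> (\<forall>i j. X i j \<ge> 0)"

lemma nonneg_partial_prod: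
  assumes "\<And>r. nonneg_mat (X r)"
  shows "nonneg_mat (partial_prod X r)"
  using assms
  by (induction r) (auto simp: nonneg_mat_def one_mat_def mat_mul_def intro!: sum_nonneg)

text \<open>The matrices \<open>E r\<close> are the successive forms of one matrix that travels to the right through a product,
changing each factor \<open>X r\<close> that it passes into \<open>Y r\<close>.\<close>
lemma partial_prod_exchange:
  assumes "\<And>r. E r \<odot> X r = Y r \<odot> E (Suc r)" "\<And>r. upper_tri (E r)"
  shows "E 0 \<odot> partial_prod X r = partial_prod Y r \<odot> E r"
proof (induction r)
  case 0
  show ?case using assms(2) by (simp add: one_mat_mul mat_mul_one)
next
  case (Suc r)
  have "E 0 \<odot> partial_prod X (Suc r) = (E 0 \<odot> partial_prod X r) \<odot> X r"
    by (simp add: mat_mul_assoc)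
  also have "\<dots> = partial_prod Y r \<odot> (E r \<odot> X r)"
    by (simp add: Suc mat_mul_assoc)
  also have "\<dots> = partial_prod Y (Suc r) \<odot> E (Suc r)"
    by (simp add: assms(1) mat_mul_assoc)
  finally show ?case .
qed

section \<open>Bidiagonal matrices and their inverses\<close>

text \<open>Whirls and Chevalley generators are both of this form, so that identities between their products
reduce to identities between the superdiagonals.\<close>
definition bidiag :: "(int \<Rightarrow> real) \<Rightarrow> imat" where
  "bidiag p i j = (if j = i then 1 else if j = i + 1 then p i else 0)"

lemma upper_tri_bidiag: "upper_tri (bidiag p)"
  by (simp add: upper_tri_def bidiag_def)

lemma bidiag_mat_mul:
  assumes "upper_tri X"
  shows "(bidiag p \<odot> X) i j = X i j + p i * X (i + 1) j"
proof (cases "i \<le> j")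
  case True
  have "(bidiag p \<odot> X) i j =
      (\<Sum>k\<in>{i..j}. (if k = i then X i j else 0) + (if k = i + 1 then p i * X (i + 1) j else 0))"
    unfolding mat_mul_def by (intro sum.cong) (auto simp: bidiag_def)
  also have "\<dots> = X i j + p i * X (i + 1) j"
    using True assms by (auto simp: sum.distrib upper_tri_zero)
  finally show ?thesis .
qed (use assms in \<open>auto simp: mat_mul_def upper_tri_zero\<close>)

lemma mat_mul_bidiag:
  assumes "upper_tri X"
  shows "(X \<odot> bidiag p) i j = X i j + X i (j - 1) * p (j - 1)"
proof (cases "i \<le> j")
  case True
  have "(X \<odot> bidiag p) i j =
      (\<Sum>k\<in>{i..j}. (if k = j then X i j else 0) + (if k = j - 1 then X i (j - 1) * p (j - 1) else 0))"
    unfolding mat_mul_def by (intro sum.cong) (auto simp: bidiag_def)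
  also have "\<dots> = X i j + X i (j - 1) * p (j - 1)"
    using True assms by (auto simp: sum.distrib upper_tri_zero)
  finally show ?thesis .
qed (use assms in \<open>auto simp: mat_mul_def upper_tri_zero\<close>)

text \<open>A product of two such matrices has only two diagonals besides the main one, and the two assumptions
compare these.\<close>
lemma bidiag_mul_eqI:
  assumes "\<And>i. p i + q i = p' i + q' i"
    and "\<And>i. p i * q (i + 1) = p' i * q' (i + 1)"
  shows "bidiag p \<odot> bidiag q = bidiag p' \<odot> bidiag q'"
proof (intro ext)
  fix i j
  show "(bidiag p \<odot> bidiag q) i j = (bidiag p' \<odot> bidiag q') i j"
    using assms(1)[of i] assms(2)[of i]
    by (auto simp: bidiag_mat_mul[OF upper_tri_bidiag] bidiag_def)
qed

text \<open>The entry \<open>(i, j)\<close> is the weight of the path \<open>i \<rightarrow> i + 1 \<rightarrow> \<dots> \<rightarrow> j\<close>: this is the geometric series that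
inverts \<open>bidiag (\<lambda>i. - p i)\<close>.\<close>
definition path_mat :: "(int \<Rightarrow> real) \<Rightarrow> imat" where
  "path_mat p i j = (if i \<le> j then \<Prod>k=i..<j. p k else 0)"

lemma upper_tri_path_mat: "upper_tri (path_mat p)"
  by (simp add: upper_tri_def path_mat_def)

lemma bidiag_path_mat: "bidiag (\<lambda>i. - p i) \<odot> path_mat p = one_mat"
proof (intro ext)
  fix i j :: int
  have "(\<Prod>k=i..<j. p k) = p i * (\<Prod>k=i+1..<j. p k)" if "i < j"
  proof -
    have "{i..<j} = insert i {i+1..<j}" using that by auto
    then show ?thesis by simp
  qed
  then show "(bidiag (\<lambda>i. - p i) \<odot> path_mat p) i j = one_mat i j"
    by (auto simp: bidiag_mat_mul[OF upper_tri_path_mat] path_mat_def one_mat_def)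
qed

lemma path_mat_bidiag: "path_mat p \<odot> bidiag (\<lambda>i. - p i) = one_mat"
proof (intro ext)
  fix i j :: int
  have "(\<Prod>k=i..<j. p k) = (\<Prod>k=i..<j-1. p k) * p (j - 1)" if "i < j"
  proof -
    have "{i..<j} = insert (j - 1) {i..<j-1}" using that by auto
    then show ?thesis by simp
  qed
  then show "(path_mat p \<odot> bidiag (\<lambda>i. - p i)) i j = one_mat i j"
    by (auto simp: mat_mul_bidiag[OF upper_tri_path_mat] path_mat_def one_mat_def)
qed

text \<open>Multiplying by the inverses of the bidiagonal matrices on both sides turns an exchange that runs from
right to left through bidiagonal matrices into one that runs from left to right through path matrices.
This is why a generator passes through a curl in the direction opposite to that for a whirl.\<close>
lemma path_mat_exchange:
  assumes "bidiag (\<lambda>i. - q' i) \<odot> X = Y \<odot> bidiag (\<lambda>i. - q i)"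
    and "upper_tri X" "upper_tri Y"
  shows "X \<odot> path_mat q = path_mat q' \<odot> Y"
proof -
  have "X \<odot> path_mat q = (path_mat q' \<odot> bidiag (\<lambda>i. - q' i)) \<odot> (X \<odot> path_mat q)"
    by (simp add: path_mat_bidiag one_mat_mul upper_tri_mat_mul)
  also have "\<dots> = path_mat q' \<odot> ((bidiag (\<lambda>i. - q' i) \<odot> X) \<odot> path_mat q)"
    by (simp add: mat_mul_assoc)
  also have "\<dots> = path_mat q' \<odot> (Y \<odot> (bidiag (\<lambda>i. - q i) \<odot> path_mat q))"
    by (simp add: assms(1) mat_mul_assoc)
  also have "\<dots> = path_mat q' \<odot> Y"
    using assms(3) by (simp add: bidiag_path_mat mat_mul_one)
  finally show ?thesis .
qed

section \<open>Whirls, curls and Chevalley generators\<close>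

lemma idx_eq_iff:
  assumes "n \<ge> 1"
  shows "idx n i = idx n j \<longleftrightarrow> [i = j] (mod int n)"
proof -
  have "(i - 1) mod int n \<ge> 0" "(j - 1) mod int n \<ge> 0"
    using assms by simp_all
  then have "idx n i = idx n j \<longleftrightarrow> [i - 1 = j - 1] (mod int n)"
    by (simp add: idx_def cong_def nat_eq_iff)
  also have "\<dots> \<longleftrightarrow> [i = j] (mod int n)"
    by (simp add: cong_iff_dvd_diff)
  finally show ?thesis .
qed

lemma idx_shift_eq_iff:
  assumes "n \<ge> 1"
  shows "idx n (i + d) = idx n (j + d) \<longleftrightarrow> idx n i = idx n j"
  using assms by (simp add: idx_eq_iff cong_iff_dvd_diff)

text \<open>This is where the restriction on \<open>n\<close> matters: for \<open>n = 1\<close> the two parameters that an exchange changes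
would coincide.\<close>
lemma idx_neighbour_neq:
  assumes "n \<ge> 2" "\<bar>d\<bar> = 1"
  shows "idx n (k + d) \<noteq> idx n k"
proof
  assume "idx n (k + d) = idx n k"
  then have "int n dvd d"
    using assms(1) by (simp add: idx_eq_iff cong_iff_dvd_diff)
  then have "int n dvd 1" using assms(2) by (metis dvd_abs_iff)
  then show False using assms(1) by simp
qed

lemma whirl_eq_bidiag: "whirl n b = bidiag (\<lambda>i. b (idx n i))"
  by (intro ext) (simp add: whirl_def bidiag_def)

lemma curl_eq_path_mat: "curl n b = path_mat (\<lambda>i. b (idx n i))"
  by (intro ext) (simp add: curl_def path_mat_def)

definition chev :: "nat \<Rightarrow> int \<Rightarrow> real \<Rightarrow> imat" where
  "chev n k a = bidiag (\<lambda>i. if idx n i = idx n k then a else 0)"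

lemma is_chevalley_eq_chev: "is_chevalley n k a E \<Longrightarrow> E = chev n k a"
  by (intro ext) (auto simp: is_chevalley_def chev_def bidiag_def idx_eq_iff)

section \<open>Moving a Chevalley generator through a whirl or a curl\<close>

text \<open>The parameter with which a generator leaves a factor with parameters \<open>b\<close>; the step \<open>d\<close> of the residue
class is 1 for whirls and -1 for curls.\<close>
definition pushed_param :: "nat \<Rightarrow> int \<Rightarrow> int \<Rightarrow> real \<Rightarrow> (nat \<Rightarrow> real) \<Rightarrow> real" where
  "pushed_param n d k a b = a * b (idx n (k + d)) / (a + b (idx n k))"

definition exchanged :: "nat \<Rightarrow> int \<Rightarrow> int \<Rightarrow> real \<Rightarrow> (nat \<Rightarrow> real) \<Rightarrow> nat \<Rightarrow> real" where
  "exchanged n d k a b =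
     b(idx n k := b (idx n k) + a,
       idx n (k + d) := b (idx n (k + d)) - pushed_param n d k a b)"

lemma pushed_param_nonneg:
  assumes "n \<ge> 1" "a \<ge> 0" "\<forall>j\<in>{1..n}. b j > 0"
  shows "pushed_param n d k a b \<ge> 0"
proof -
  have "b (idx n k) > 0" "b (idx n (k + d)) > 0"
    using assms idx_in_range by blast+
  then show ?thesis
    using assms(2) by (simp add: pushed_param_def)
qed

lemma pushed_param_less:
  assumes "n \<ge> 1" "a \<ge> 0" "\<forall>j\<in>{1..n}. b j > 0"
  shows "pushed_param n d k a b < b (idx n (k + d))"
proof -
  have "b (idx n k) > 0" "b (idx n (k + d)) > 0"
    using assms idx_in_range by blast+
  then show ?thesis
    using assms(2) by (simp add: pushed_param_def divide_less_eq distrib_left mult.commute)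
qed

lemma exchanged_pos:
  assumes "n \<ge> 1" "a \<ge> 0" "\<forall>j\<in>{1..n}. b j > 0"
  shows "\<forall>j\<in>{1..n}. exchanged n d k a b j > 0"
  using assms pushed_param_less[OF assms, of d k]
  by (auto simp: exchanged_def intro: add_pos_nonneg)

lemma exchanged_le:
  assumes "n \<ge> 1" "a \<ge> 0" "\<forall>j\<in>{1..n}. b j > 0"
  shows "exchanged n d k a b j \<le> b j + a"
  using assms pushed_param_nonneg[OF assms, of d k] by (auto simp: exchanged_def)

text \<open>Comparing superdiagonals gives \<open>b'\<^sub>k = b\<^sub>k + a\<close> and \<open>b'\<^sub>k\<^sub>+\<^sub>1 = b\<^sub>k\<^sub>+\<^sub>1 - a'\<close>. The second diagonal
of the left side is nonzero only in rows in the class of \<open>k\<close>, where it requires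
\<open>a b\<^sub>k\<^sub>+\<^sub>1 = b'\<^sub>k a'\<close>; this determines \<open>a'\<close>.\<close>
lemma chev_whirl:
  assumes "n \<ge> 2" "a \<ge> 0" "\<forall>j\<in>{1..n}. b j > 0"
  shows "chev n k a \<odot> whirl n b
       = whirl n (exchanged n 1 k a b) \<odot> chev n (k + 1) (pushed_param n 1 k a b)"
proof -
  have "b (idx n k) > 0"
    using assms idx_in_range[of n k] by auto
  then have res: "(b (idx n k) + a) * pushed_param n 1 k a b = a * b (idx n (k + 1))"
    using assms(2) by (simp add: pushed_param_def add.commute)
  have shift: "idx n (i + 1) = idx n (k + 1) \<longleftrightarrow> idx n i = idx n k" for i
    using assms(1) by (simp add: idx_shift_eq_iff)
  note neq = idx_neighbour_neq[OF assms(1), of 1 k, simplified]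
  show ?thesis
    unfolding chev_def whirl_eq_bidiag
  proof (rule bidiag_mul_eqI, goal_cases)
    case (1 i)
    show ?case using neq by (auto simp: exchanged_def)
  next
    case (2 i)
    show ?case
    proof (cases "idx n i = idx n k")
      case True
      then have "idx n (i + 1) = idx n (k + 1)" by (simp add: shift)
      with True res neq show ?thesis by (simp add: exchanged_def)
    qed (simp add: shift)
  qed
qed

text \<open>Since the curl of \<open>b\<close> is the inverse of the bidiagonal matrix with superdiagonal \<open>-b\<close>, the identity
is equivalent to one between bidiagonal matrices in which a generator \<open>e (k - 1) a'\<close> on the left becomes
\<open>e k a\<close> on the right. Its product condition, in the rows in the class of \<open>k - 1\<close>, is
\<open>b'\<^sub>k\<^sub>-\<^sub>1 a = a' b\<^sub>k\<close>.\<close>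
lemma chev_curl:
  assumes "n \<ge> 2" "a \<ge> 0" "\<forall>j\<in>{1..n}. b j > 0"
  shows "chev n k a \<odot> curl n b
       = curl n (exchanged n (- 1) k a b) \<odot> chev n (k - 1) (pushed_param n (- 1) k a b)"
proof -
  let ?r = "pushed_param n (- 1) k a b"
  have "b (idx n k) > 0"
    using assms idx_in_range[of n k] by auto
  then have res: "(b (idx n (k - 1)) - ?r) * a = ?r * b (idx n k)"
    using assms(2) by (simp add: pushed_param_def field_simps)
  have shift: "idx n (i + 1) = idx n k \<longleftrightarrow> idx n i = idx n (k - 1)" for i
    using assms(1) idx_shift_eq_iff[of n i 1 "k - 1"] by simp
  have cong: "idx n (i + 1) = idx n k" if "idx n i = idx n (k - 1)" for i
    using shift that by simp
  note neq = idx_neighbour_neq[OF assms(1), of "-1" k, simplified]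
  have "bidiag (\<lambda>i. - exchanged n (- 1) k a b (idx n i)) \<odot> chev n k a
      = chev n (k - 1) ?r \<odot> bidiag (\<lambda>i. - b (idx n i))"
    unfolding chev_def
    by (rule bidiag_mul_eqI) (use res neq in \<open>auto simp: exchanged_def shift cong\<close>)
  then show ?thesis
    unfolding curl_eq_path_mat
    by (rule path_mat_exchange) (simp_all add: chev_def upper_tri_bidiag)
qed

section \<open>Passing to the limit\<close>

lemma admissible_iff_summable:
  "admissible n b \<longleftrightarrow>
     (\<forall>r. \<forall>j\<in>{1..n}. b r j > 0) \<and> (\<forall>j\<in>{1..n}. summable (\<lambda>r. b r j))"
proof (cases "\<forall>r. \<forall>j\<in>{1..n}. b r j > 0")
  case pos: True
  have "((\<lambda>(r, j). b r j) summable_on UNIV \<times> {1..n})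
      \<longleftrightarrow> (\<lambda>(j, r). b r j) summable_on {1..n} \<times> UNIV"
    using summable_on_reindex[of prod.swap "{1..n} \<times> (UNIV :: nat set)" "\<lambda>(r, j). b r j"]
    by (simp add: product_swap o_def case_prod_unfold)
  also have "\<dots> \<longleftrightarrow> (\<forall>j\<in>{1..n}. (\<lambda>r. b r j) summable_on UNIV)"
  proof
    assume L: "(\<lambda>(j, r). b r j) summable_on {1..n} \<times> UNIV"
    show "\<forall>j\<in>{1..n}. (\<lambda>r. b r j) summable_on UNIV"
      using summable_on_SigmaD1[OF L] by simp
  next
    assume R: "\<forall>j\<in>{1..n}. (\<lambda>r. b r j) summable_on UNIV"
    show "(\<lambda>(j, r). b r j) summable_on {1..n} \<times> UNIV"
      by (rule summable_on_SigmaI[where g = "\<lambda>j. infsum (\<lambda>r. b r j) UNIV"])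
         (use R pos in \<open>auto intro: less_imp_le\<close>)
  qed
  also have "\<dots> \<longleftrightarrow> (\<forall>j\<in>{1..n}. summable (\<lambda>r. b r j))"
    using pos by (intro ball_cong refl summable_on_UNIV_nonneg_real_iff) (auto intro: less_imp_le)
  finally show ?thesis
    using pos by (simp add: admissible_def)
qed (auto simp: admissible_def)

text \<open>Moving the generator through the first \<open>r\<close> factors leaves one with parameter \<open>a r\<close> on the right, which
adds to each column of the new partial product at most \<open>a r\<close> times the preceding column. The new partial
products are nonnegative, hence bounded entrywise by the convergent matrices \<open>E \<odot> X 0 \<odot> \<dots> \<odot> X (r - 1)\<close>;
so this contribution tends to 0.\<close>
lemma infinite_prod_exchange:
  assumes prod: "is_infinite_prod X P"
    and exch: "\<And>r. chev n (k r) (a r) \<odot> X r = Y r \<odot> chev n (k (Suc r)) (a (Suc r))"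
    and nonneg: "\<And>r. nonneg_mat (Y r)" "\<And>r. a r \<ge> 0"
    and lim: "a \<longlonglongrightarrow> 0"
  shows "is_infinite_prod Y (chev n (k 0) (a 0) \<odot> P)"
  unfolding is_infinite_prod_def
proof (intro allI)
  fix i j
  let ?E = "chev n (k 0) (a 0)"
  define Q where "Q r = ?E \<odot> partial_prod X r" for r
  define c where "c r = (if idx n (j - 1) = idx n (k r) then a r else 0)" for r
  have Q_lim: "(\<lambda>r. Q r i' j') \<longlonglongrightarrow> (?E \<odot> P) i' j'" for i' j'
    unfolding Q_def mat_mul_def
    by (intro tendsto_intros) (use prod in \<open>auto simp: is_infinite_prod_def\<close>)
  have Q_eq: "Q r = partial_prod Y r \<odot> chev n (k r) (a r)" for r
    unfolding Q_def
    by (rule partial_prod_exchange[where E = "\<lambda>r. chev n (k r) (a r)"])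
       (use exch in \<open>auto simp: chev_def upper_tri_bidiag\<close>)
  have Y_nonneg: "partial_prod Y r i' j' \<ge> 0" for r i' j'
    using nonneg_partial_prod[of Y] nonneg(1) by (auto simp: nonneg_mat_def)
  have Y_le: "partial_prod Y r i' j' \<le> Q r i' j'" for r i' j'
    using Y_nonneg nonneg(2)
    by (simp add: Q_eq chev_def mat_mul_bidiag[OF upper_tri_partial_prod])
  have Y_eq: "partial_prod Y r i j = Q r i j - partial_prod Y r i (j - 1) * c r" for r
    by (simp add: Q_eq chev_def mat_mul_bidiag[OF upper_tri_partial_prod] c_def)
  have "(\<lambda>r. partial_prod Y r i (j - 1) * c r) \<longlonglongrightarrow> 0"
  proof (rule tendsto_sandwich[of "\<lambda>_. 0" _ _ "\<lambda>r. Q r i (j - 1) * a r"])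
    show "(\<lambda>r. Q r i (j - 1) * a r) \<longlonglongrightarrow> 0"
      using tendsto_mult[OF Q_lim lim] by simp
    have "partial_prod Y r i (j - 1) * c r \<le> Q r i (j - 1) * a r" for r
      using order_trans[OF Y_nonneg Y_le]
      by (intro mult_mono) (auto simp: Y_le c_def nonneg)
    then show "\<forall>\<^sub>F r in sequentially. partial_prod Y r i (j - 1) * c r \<le> Q r i (j - 1) * a r"
      by simp
  qed (use Y_nonneg nonneg(2) in \<open>auto simp: c_def\<close>)
  then show "(\<lambda>r. partial_prod Y r i j) \<longlonglongrightarrow> (?E \<odot> P) i j"
    unfolding Y_eq using tendsto_diff[OF Q_lim] by fastforce
qed

text \<open>The parameter of the generator after passing the factor \<open>r\<close> is smaller than one of the parameters of
that factor, and so smaller than their sum. Summability of the \<open>b r j\<close> over all \<open>r\<close> and \<open>j\<close> thus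
makes these parameters summable; they tend to 0, and the new parameters, which exceed the old ones by
no more than this, are again admissible.\<close>
lemma chev_absorbed:
  fixes F :: "(nat \<Rightarrow> real) \<Rightarrow> imat"
  assumes n: "n \<ge> 1" and a: "a \<ge> 0"
    and exch: "\<And>k a b. a \<ge> 0 \<Longrightarrow> \<forall>j\<in>{1..n}. b j > 0 \<Longrightarrow>
      chev n k a \<odot> F b = F (exchanged n d k a b) \<odot> chev n (k + d) (pushed_param n d k a b)"
    and nonneg: "\<And>b. \<forall>j\<in>{1..n}. b j > 0 \<Longrightarrow> nonneg_mat (F b)"
    and b: "admissible n b" and prod: "is_infinite_prod (\<lambda>r. F (b r)) X"
  shows "\<exists>b'. admissible n b' \<and> is_infinite_prod (\<lambda>r. F (b' r)) (chev n k a \<odot> X)"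
proof -
  \<comment> \<open>\<open>K r\<close> and \<open>A r\<close> are the class and the parameter of the generator on reaching the factor \<open>r\<close>.\<close>
  define K where "K r = k + int r * d" for r
  define A where "A = rec_nat a (\<lambda>r x. pushed_param n d (K r) x (b r))"
  define b' where "b' r = exchanged n d (K r) (A r) (b r)" for r
  have A_Suc: "A (Suc r) = pushed_param n d (K r) (A r) (b r)" for r
    by (simp add: A_def)
  have K_Suc: "K (Suc r) = K r + d" for r
    by (simp add: K_def algebra_simps)
  have pos: "\<forall>j\<in>{1..n}. b r j > 0" for r
    using b by (simp add: admissible_iff_summable)
  have A_nonneg: "A r \<ge> 0" for r
    by (induction r) (use a in \<open>simp_all add: A_Suc pushed_param_nonneg[OF n _ pos]\<close>, simp add: A_def)
  have "A (Suc r) \<le> (\<Sum>j\<in>{1..n}. b r j)" for r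
  proof -
    have "A (Suc r) \<le> b r (idx n (K r + d))"
      unfolding A_Suc by (rule less_imp_le[OF pushed_param_less[OF n A_nonneg pos]])
    also have "\<dots> \<le> (\<Sum>j\<in>{1..n}. b r j)"
      using pos idx_in_range[OF n] by (intro member_le_sum) (auto intro: less_imp_le)
    finally show ?thesis .
  qed
  moreover have "summable (\<lambda>r. \<Sum>j\<in>{1..n}. b r j)"
    using b by (intro summable_sum) (auto simp: admissible_iff_summable)
  ultimately have "summable (\<lambda>r. A (Suc r))"
    using A_nonneg by (auto intro: summable_comparison_test'[of "\<lambda>r. \<Sum>j\<in>{1..n}. b r j" 0])
  then have A_summable: "summable A"
    by (simp add: summable_Suc_iff)
  have b'_pos: "\<forall>j\<in>{1..n}. b' r j > 0" for r
    unfolding b'_def by (rule exchanged_pos[OF n A_nonneg pos])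
  have "summable (\<lambda>r. b' r j)" if j: "j \<in> {1..n}" for j
  proof (rule summable_comparison_test'[where N = 0])
    show "summable (\<lambda>r. b r j + A r)"
      using b j A_summable by (intro summable_add) (auto simp: admissible_iff_summable)
    show "norm (b' r j) \<le> b r j + A r" for r
      using bspec[OF b'_pos[of r] j] exchanged_le[OF n A_nonneg pos, of d "K r" r r j] by (simp add: b'_def)
  qed
  then have "admissible n b'"
    using b'_pos by (simp add: admissible_iff_summable)
  moreover have "is_infinite_prod (\<lambda>r. F (b' r)) (chev n (K 0) (A 0) \<odot> X)"
  proof (rule infinite_prod_exchange[OF prod])
    show "chev n (K r) (A r) \<odot> F (b r) = F (b' r) \<odot> chev n (K (Suc r)) (A (Suc r))" for r
      unfolding A_Suc K_Suc b'_def by (rule exch[OF A_nonneg pos])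
    show "A \<longlonglongrightarrow> 0"
      using A_summable by (rule summable_LIMSEQ_zero)
  qed (simp_all add: nonneg b'_pos A_nonneg)
  ultimately show ?thesis
    by (auto simp: K_def A_def)
qed

theorem theorem9p6:
  fixes n :: nat and i :: int and a :: real and E :: imat
  assumes "n \<ge> 1" and "a \<ge> 0" and "is_chevalley n i a E"
  shows "(\<forall>X. X \<in> RW n \<longrightarrow> E \<odot> X \<in> RW n) \<and> (\<forall>X. X \<in> RC n \<longrightarrow> E \<odot> X \<in> RC n)"
proof -
  have n2: "n \<ge> 2"
    using assms(3) by (simp add: is_chevalley_def)
  have E: "E = chev n i a"
    using assms(3) by (rule is_chevalley_eq_chev)
  have idx_nonneg: "b (idx n j) \<ge> 0" if "\<forall>j\<in>{1..n}. b j > 0" for j and b :: "nat \<Rightarrow> real"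
    using that idx_in_range[OF assms(1), of j] by (auto intro: less_imp_le)
  have whirl_nonneg: "nonneg_mat (whirl n b)" if "\<forall>j\<in>{1..n}. b j > 0" for b
    using idx_nonneg[OF that] by (simp add: nonneg_mat_def whirl_def)
  have curl_nonneg: "nonneg_mat (curl n b)" if "\<forall>j\<in>{1..n}. b j > 0" for b
    using idx_nonneg[OF that] by (simp add: nonneg_mat_def curl_def prod_nonneg)
  show ?thesis
  proof (intro conjI allI impI)
    fix X assume X: "X \<in> RW n"
    then show "E \<odot> X \<in> RW n"
      using X chev_absorbed[OF assms(1,2), where F = "whirl n" and d = 1] chev_whirl[OF n2]
        whirl_nonneg
      unfolding RW_def E by auto
  next
    fix X assume X: "X \<in> RC n"
    then show "E \<odot> X \<in> RC n"
      using X chev_absorbed[OF assms(1,2), where F = "curl n" and d = "- 1"] chev_curl[OF n2]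
        curl_nonneg
      unfolding RC_def E by auto
  qed
qed

end
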